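(* Let $U$ be the unitary transformation on $L^2_{\mathbb{C}}(V\times S)$ associated with a discrete-time quantum walk (not necessarily coined) on a finite graph $G=(V,E)$ with finite set of states $S$. Suppose that $U$ has only real eigenvectors. Let $\lambda$ and $\lambda'$ be two distinct eigenvalues of $U$ with the corresponding eigenvectors $\psi$ and $\psi'$ (of unit norm). Assume that $d(\lambda,\lambda')\le 2$ and $\varepsilon\le Q(\psi,\psi')/80$. Then $$t_{mix}(\varepsilon)\ge \frac{Q(\psi,\psi')}{8\,\varepsilon\, d(\lambda,\lambda')}.$$
   Context: Quantum walk: $G=(V,E)$ is a finite graph, $S$ is a finite set (of "chiralities"), and $U$ is a unitary operator on $L^2_{\mathbb{C}}(V\times S)$. The walk is assumed local: with $\delta_x$ the standard basis vectors, if $x=(v,s)$, $x'=(v',s')$ and $\langle\delta_{x'},U\delta_x\rangle\ne 0$, then $v$ and $v'$ are connected to each other in $G$. For an initial wave function $\varphi\in L^2_{\mathbb{C}}(V\times S)$ with $\|\varphi\|=1$, put $\varphi_t=U^t\varphi$. ("Not necessarily coined" means that $U$ need not have the special form given by a coin matrix acting on $S$ followed by moves along labelled edges; any local unitary $U$ is allowed.) Mixing time: the limit $$p(x)=\lim_{T\to\infty}\frac1T\sum_{t=0}^{T-1}|\varphi_t(x)|^2$$ exists for each $x$ (and may depend on $\varphi$). For $T=1,2,\dots$ let $$d(T,\varphi)=\sum_{x\in V\times S}\left|\frac1T\sum_{t=0}^{T-1}|\varphi_t(x)|^2-p(x)\right|.$$ The mixing time, for $\varepsilon>0$, is $$t_{mix}(\varepsilon)=\sup_{\varphi}\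 \inf\{T: d(T',\varphi)\le\varepsilon \text{ for all } T'\ge T\},$$ the supremum being over all wave functions $\varphi$ with $\|\varphi\|=1$. Distance of eigenvalues: for $\lambda=e^{i\beta}$ and $\lambda'=e^{i\beta'}$ on the unit circle, $d(\lambda,\lambda')=\min\{|\beta-\beta'+2\pi n|:n\in\mathbb{Z}\}$. Overlap: $Q(\varphi,\psi)=\sum_{x\in V\times S}|\varphi(x)\psi(x)|$. *)

theory Defs
  imports "HOL-Analysis.Analysis"
begin

text \<open>
  The space of complex functions on a finite set is the type \<open>complex ^ 'x\<close> with \<open>'x\<close> finite; its
  library norm is the \<open>L\<^sup>2\<close> norm.  The library inner product on this type is the real one
  (the real part of the Hermitian product), so the Hermitian product is defined here.
\<close>

definition hermitian :: "complex ^ 'x \<Rightarrow> complex ^ 'x \<Rightarrow> complex" where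
  "hermitian f g = (\<Sum>x\<in>UNIV. cnj (f $ x) * g $ x)"

definition unitary_operator :: "(complex ^ 'x \<Rightarrow> complex ^ 'x) \<Rightarrow> bool" where
  "unitary_operator U \<longleftrightarrow>
     Vector_Spaces.linear (*s) (*s) U \<and> surj U \<and>
     (\<forall>f g. hermitian (U f) (U g) = hermitian f g)"

text \<open>
  The vertex set is the type \<open>'v\<close>, the set of chiralities the type \<open>'s\<close>.  The graph is undirected
  and loops are permitted, so that walks which may stay at a vertex are not excluded.
  The vector \<open>\<delta>\<^sub>x\<close> is \<open>axis x 1\<close>.
\<close>

definition quantum_walk ::
  "('v \<times> 'v) set \<Rightarrow> (complex ^ ('v::finite \<times> 's::finite) \<Rightarrow> complex ^ ('v \<times> 's)) \<Rightarrow> bool" where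
  "quantum_walk E U \<longleftrightarrow>
     sym E \<and> unitary_operator U \<and>
     (\<forall>v s v' s'. hermitian (axis (v', s') 1) (U (axis (v, s) 1)) \<noteq> 0 \<longrightarrow> (v, v') \<in> E)"

definition eigenvector ::
  "(complex ^ 'x \<Rightarrow> complex ^ 'x) \<Rightarrow> complex \<Rightarrow> complex ^ 'x \<Rightarrow> bool" where
  "eigenvector U l f \<longleftrightarrow> f \<noteq> 0 \<and> U f = l *s f"

definition real_vector :: "complex ^ 'x \<Rightarrow> bool" where
  "real_vector f \<longleftrightarrow> (\<forall>x. f $ x \<in> \<real>)"

definition real_up_to_phase :: "complex ^ 'x \<Rightarrow> bool" where
  "real_up_to_phase f \<longleftrightarrow> (\<exists>c. cmod c = 1 \<and> real_vector (c *s f))"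

text \<open>
  Multiplying a real eigenvector by \<open>\<i>\<close>, or combining two real eigenvectors of a multiple eigenvalue
  with complex coefficients, gives eigenvectors that are not real.  Hence an operator ``has only
  real eigenvectors'' if it has an orthonormal basis of real eigenvectors.  (An orthonormal family
  indexed by \<open>'x\<close> has as many members as the dimension, hence is a basis.)
\<close>

definition only_real_eigenvectors :: "(complex ^ 'x \<Rightarrow> complex ^ 'x) \<Rightarrow> bool" where
  "only_real_eigenvectors U \<longleftrightarrow>
     (\<exists>b :: 'x \<Rightarrow> complex ^ 'x.
        (\<forall>i j. hermitian (b i) (b j) = (if i = j then 1 else 0)) \<and>
        (\<forall>i. real_vector (b i) \<and> (\<exists>l. eigenvector U l (b i))))"

definition time_average ::
  "(complex ^ 'x \<Rightarrow> complex ^ 'x) \<Rightarrow> complex ^ 'x \<Rightarrow> nat \<Rightarrow> 'x \<Rightarrow> real" where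
  "time_average U \<phi> T x = (1 / real T) * (\<Sum>t<T. (cmod ((U ^^ t) \<phi> $ x))\<^sup>2)"

definition limit_distribution ::
  "(complex ^ 'x \<Rightarrow> complex ^ 'x) \<Rightarrow> complex ^ 'x \<Rightarrow> 'x \<Rightarrow> real" where
  "limit_distribution U \<phi> x = lim (\<lambda>T. time_average U \<phi> T x)"

definition mixing_distance ::
  "(complex ^ 'x \<Rightarrow> complex ^ 'x) \<Rightarrow> nat \<Rightarrow> complex ^ 'x \<Rightarrow> real" where
  "mixing_distance U T \<phi> =
     (\<Sum>x\<in>UNIV. \<bar>time_average U \<phi> T x - limit_distribution U \<phi> x\<bar>)"

text \<open>
  Extended reals, so that the infimum and the supremum need no side conditions (the infimum of the
  empty set is \<open>\<infinity>\<close>).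
\<close>

definition mixing_time :: "(complex ^ 'x \<Rightarrow> complex ^ 'x) \<Rightarrow> real \<Rightarrow> ereal" where
  "mixing_time U \<epsilon> =
     (SUP \<phi>\<in>{\<phi>. norm \<phi> = 1}.
        INF T\<in>{T. 1 \<le> T \<and> (\<forall>T'\<ge>T. mixing_distance U T' \<phi> \<le> \<epsilon>)}. ereal (real T))"

text \<open>
  Meant for arguments on the unit circle.  Changing the arguments \<open>\<beta>\<close>, \<open>\<beta>'\<close> by multiples of \<open>2\<pi>\<close>
  only permutes the values, so the principal arguments may be used; the infimum is attained.
\<close>

definition circle_dist :: "complex \<Rightarrow> complex \<Rightarrow> real" where
  "circle_dist l l' = (INF n::int. \<bar>Arg l - Arg l' + 2 * pi * of_int n\<bar>)"

definition overlap :: "complex ^ 'x \<Rightarrow> complex ^ 'x \<Rightarrow> real" where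
  "overlap \<phi> \<psi> = (\<Sum>x\<in>UNIV. cmod (\<phi> $ x * \<psi> $ x))"

end

theory Submission imports Defs begin

text \<open>
  The walk is started in a superposition \<open>(f + \<omega> g) / \<surd>2\<close> of the two eigenvectors, rephased to be real.
  By reality, the deviation of the time average from its limit at \<open>x\<close> factors as \<open>f x g x\<close> times
  \<open>Re (\<omega> (1 + z + \<dots> + z\<^sup>T\<^sup>-\<^sup>1)) / T\<close>, where \<open>z\<close> is the quotient of the eigenvalues, so the mixing distance is
  the overlap times the modulus of the second factor.  The geometric sum is large whenever
  \<open>T d / 2\<close> is far from the multiples of \<open>\<pi>\<close>, which happens for some \<open>T\<close> between the claimed bound and
  twice the claimed bound, and the phase \<open>\<omega>\<close> is chosen to make its real part its modulus for that \<open>T\<close>.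
\<close>

subsection \<open>The Hermitian product\<close>

lemma hermitian_self: "hermitian f f = of_real ((norm f)\<^sup>2)"
  by (simp add: hermitian_def norm_vec_def L2_set_def sum_nonneg complex_norm_square mult.commute
      del: of_real_power)

lemma hermitian_scale: "hermitian (a *s f) (b *s g) = cnj a * b * hermitian f g"
  by (simp add: hermitian_def sum_distrib_left mult_ac)

lemma hermitian_add_left: "hermitian (f + g) h = hermitian f h + hermitian g h"
  by (simp add: hermitian_def sum.distrib algebra_simps)

lemma hermitian_add_right: "hermitian h (f + g) = hermitian h f + hermitian h g"
  by (simp add: hermitian_def sum.distrib algebra_simps)

lemma hermitian_commute: "hermitian g f = cnj (hermitian f g)"
  by (simp add: hermitian_def mult.commute)

lemma norm_scale_phase:
  fixes f :: "complex ^ 'x"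
  shows "cmod c = 1 \<Longrightarrow> norm (c *s f) = norm f"
  by (simp add: norm_vec_def L2_set_def norm_mult)

lemma eigenvector_scale:
  assumes "unitary_operator U" "eigenvector U l f" "c \<noteq> 0"
  shows "eigenvector U l (c *s f)"
proof -
  have "Vector_Spaces.linear (*s) (*s) U"
    using assms(1) by (simp add: unitary_operator_def)
  then have "U (c *s f) = c *s U f"
    by (rule vec.linear_scale)
  with assms show ?thesis
    by (auto simp: eigenvector_def vector_smult_assoc mult.commute)
qed

lemma eigenvalue_unitary:
  assumes "unitary_operator U" "eigenvector U l f"
  shows "cmod l = 1"
proof -
  have "hermitian (l *s f) (l *s f) = hermitian f f"
    using assms by (metis eigenvector_def unitary_operator_def)
  moreover have "hermitian f f \<noteq> 0"
    using assms(2) by (simp add: hermitian_self eigenvector_def)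
  ultimately have "cnj l * l = 1"
    by (simp add: hermitian_scale)
  then have "complex_of_real ((cmod l)\<^sup>2) = 1"
    by (simp only: complex_norm_square mult.commute)
  then show ?thesis
    by (simp only: of_real_eq_1_iff) (simp add: abs_square_eq_1)
qed

lemma cnj_mult_eq_1_iff:
  assumes "cmod l = 1"
  shows "cnj l * l' = 1 \<longleftrightarrow> l = l'"
proof -
  have "l * cnj l = 1"
    using assms by (simp add: complex_norm_square[symmetric])
  then show ?thesis
    by (metis mult.assoc mult.commute mult.left_neutral)
qed

lemma eigenvectors_orthogonal:
  assumes "unitary_operator U" "eigenvector U l f" "eigenvector U l' g" "l \<noteq> l'"
  shows "hermitian f g = 0"
proof (rule ccontr)
  assume "hermitian f g \<noteq> 0"
  moreover have "hermitian (l *s f) (l' *s g) = hermitian f g"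
    using assms by (metis eigenvector_def unitary_operator_def)
  ultimately have "cnj l * l' = 1"
    by (simp add: hermitian_scale)
  with assms(4) show False
    using cnj_mult_eq_1_iff eigenvalue_unitary[OF assms(1,2)] by simp
qed

lemma norm_superposition:
  assumes "hermitian f g = 0" "norm f = 1" "norm g = 1" "(cmod a)\<^sup>2 + (cmod b)\<^sup>2 = 1"
  shows "norm (a *s f + b *s g) = 1"
proof -
  have "hermitian g f = 0"
    using assms(1) by (simp add: hermitian_commute[of g f])
  moreover have "hermitian f f = 1" "hermitian g g = 1"
    using assms(2,3) by (simp_all add: hermitian_self)
  ultimately have "hermitian (a *s f + b *s g) (a *s f + b *s g) =
      of_real ((cmod a)\<^sup>2 + (cmod b)\<^sup>2)"
    using assms(1) unfolding of_real_add complex_norm_square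
    by (simp add: hermitian_add_left hermitian_add_right hermitian_scale mult.commute)
  then have "(norm (a *s f + b *s g))\<^sup>2 = 1"
    unfolding hermitian_self assms(4) of_real_eq_iff .
  then show ?thesis
    by (simp add: abs_square_eq_1)
qed

lemma funpow_superposition:
  assumes "unitary_operator U" "eigenvector U l f" "eigenvector U l' g"
  shows "(U ^^ t) (a *s f + b *s g) = (a * l ^ t) *s f + (b * l' ^ t) *s g"
proof (induction t)
  case (Suc t)
  have lin: "Vector_Spaces.linear (*s) (*s) U"
    using assms(1) by (simp add: unitary_operator_def)
  have "U f = l *s f" "U g = l' *s g"
    using assms by (simp_all add: eigenvector_def)
  then show ?case
    by (simp add: Suc vec.linear_add[OF lin] vec.linear_scale[OF lin]
        vector_smult_assoc mult_ac)
qed simp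

subsection \<open>Distance on the circle\<close>

text \<open>Up to the factor \<open>2 * pi\<close>, the quantity minimised is the distance from
  \<open>a / (2 * pi)\<close> to an integer, so rounding to the nearest integer attains the
  infimum.\<close>

lemma circle_dist_attained: "\<exists>n::int. circle_dist l l' = \<bar>Arg l - Arg l' + 2 * pi * of_int n\<bar>"
proof -
  define a where "a = Arg l - Arg l'"
  define n where "n = - round (a / (2 * pi))"
  have "\<bar>a + 2 * pi * of_int n\<bar> \<le> \<bar>a + 2 * pi * of_int m\<bar>" for m
  proof -
    have scale: "\<bar>a + 2 * pi * of_int k\<bar> = 2 * pi * \<bar>a / (2 * pi) - of_int (- k)\<bar>" for k
    proof -
      have "a + 2 * pi * of_int k = 2 * pi * (a / (2 * pi) - of_int (- k))"
        by (simp add: field_simps)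
      then show ?thesis by (simp add: abs_mult)
    qed
    show ?thesis
      unfolding scale using round_diff_minimal[of "a / (2 * pi)" "- m"]
      by (intro mult_left_mono) (simp_all add: n_def)
  qed
  then have "circle_dist l l' = \<bar>a + 2 * pi * of_int n\<bar>"
    unfolding circle_dist_def a_def[symmetric] by (intro cInf_eq_minimum) auto
  then show ?thesis by (auto simp: a_def)
qed

text \<open>The chord from 1 to \<open>cis x\<close> has length
  \<open>2 * \<bar>sin (x / 2)\<bar>\<close>, and \<open>cnj l * l'\<close> has an angle equal to
  \<open>circle_dist l l'\<close> up to a sign that the modulus ignores.\<close>

lemma norm_quotient_power_minus_1:
  assumes "cmod l = 1" "cmod l' = 1"
  shows "cmod ((cnj l * l') ^ T - 1) = 2 * \<bar>sin (real T * (circle_dist l l' / 2))\<bar>"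
proof -
  obtain n :: int where n: "circle_dist l l' = \<bar>Arg l - Arg l' + 2 * pi * of_int n\<bar>"
    using circle_dist_attained by blast
  define \<theta> where "\<theta> = - (Arg l - Arg l' + 2 * pi * of_int n)"
  have l: "l = cis (Arg l)" "l' = cis (Arg l')"
    using assms by (metis cis_Arg norm_zero sgn_eq div_by_1 of_real_1 zero_neq_one)+
  have "cnj l * l' = cis (Arg l' - Arg l)"
    by (subst l(1), subst l(2)) (simp add: cis_cnj cis_mult)
  also have "\<dots> = cis (Arg l' - Arg l) * cis (2 * pi * of_int (- n))"
    by (subst cis_multiple_2pi) auto
  also have "\<dots> = cis \<theta>"
    by (simp add: cis_mult \<theta>_def algebra_simps)
  finally have "(cnj l * l') ^ T = exp (\<i> * complex_of_real (real T * \<theta>))"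
    by (simp only: Complex.DeMoivre) (simp only: cis_conv_exp)
  then have "cmod ((cnj l * l') ^ T - 1) = 2 * \<bar>sin (real T * \<theta> / 2)\<bar>"
    by (simp only: dist_exp_i_1)
  moreover have "\<theta> = circle_dist l l' \<or> \<theta> = - circle_dist l l'"
    by (auto simp: n \<theta>_def abs_if)
  ultimately show ?thesis by auto
qed

text \<open>The sine has modulus at least 1/2 from \<open>pi * m + pi / 6\<close> to
  \<open>pi * m + 5 * pi / 6\<close>. This window is longer than 1, so steps of length
  \<open>\<alpha> \<le> 1\<close> cannot jump over it, and \<open>5 \<le> L * \<alpha>\<close>
  leaves room to enter one between \<open>L * \<alpha>\<close> and twice that value.\<close>

lemma exists_time_away_from_multiples_of_pi:
  fixes \<alpha> L :: real
  assumes "0 < \<alpha>" "\<alpha> \<le> 1" "5 \<le> L * \<alpha>"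
  shows "\<exists>T::nat. L \<le> real T \<and> real T \<le> 2 * L \<and> \<bar>sin (real T * \<alpha>)\<bar> \<ge> 1 / 2"
proof -
  define m where "m = \<lceil>L * \<alpha> / pi\<rceil>"
  \<comment> \<open>The first time at which \<open>T * \<alpha>\<close> has entered the window;
    rounding up overshoots its left end by at most \<open>\<alpha>\<close>.\<close>
  define T where "T = nat \<lceil>(pi * of_int m + pi / 6) / \<alpha>\<rceil>"
  have m: "L * \<alpha> \<le> pi * of_int m" "pi * of_int m \<le> L * \<alpha> + pi"
  proof -
    have "L * \<alpha> / pi \<le> of_int m" "of_int m \<le> L * \<alpha> / pi + 1"
      unfolding m_def by linarith+
    then show "L * \<alpha> \<le> pi * of_int m" "pi * of_int m \<le> L * \<alpha> + pi"
      by (simp_all add: field_simps)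
  qed
  have pos: "0 \<le> (pi * of_int m + pi / 6) / \<alpha>"
    using m(1) assms by (intro divide_nonneg_pos) (auto intro: add_nonneg_nonneg)
  have "(pi * of_int m + pi / 6) / \<alpha> \<le> real T" "real T \<le> (pi * of_int m + pi / 6) / \<alpha> + 1"
    using pos unfolding T_def by linarith+
  then have T: "pi * of_int m + pi / 6 \<le> real T * \<alpha>" "real T * \<alpha> \<le> pi * of_int m + pi / 6 + \<alpha>"
    using assms(1) by (simp_all add: field_simps)
  \<comment> \<open>Keeps \<open>pi + pi / 6 + \<alpha>\<close>, which bounds how far
    \<open>T * \<alpha>\<close> lies beyond \<open>L * \<alpha>\<close>, below 5.\<close>
  have "pi \<le> 16 / 5"
    using pi_approx(2) by simp
  then have "L * \<alpha> \<le> real T * \<alpha>" "real T * \<alpha> \<le> L * \<alpha> + L * \<alpha>"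
    using T m assms pi_gt3 by linarith+
  then have "L \<le> real T" "real T \<le> 2 * L"
    using assms(1) by (simp_all flip: distrib_right mult_2)
  moreover have "\<bar>sin (real T * \<alpha>)\<bar> \<ge> 1 / 2"
  proof -
    define y where "y = real T * \<alpha> - pi * of_int m"
    have y: "pi / 6 \<le> y" "y \<le> pi - pi / 6"
      using T assms(2) pi_gt3 by (simp_all add: y_def)
    have "sin y \<ge> 1 / 2"
    proof (cases "y \<le> pi / 2")
      case True
      then have "sin (pi / 6) \<le> sin y"
        using y by (intro sin_monotone_2pi_le) auto
      then show ?thesis by (simp add: sin_30)
    next
      case False
      then have "sin (pi / 6) \<le> sin (pi - y)"
        using y by (intro sin_monotone_2pi_le) auto
      then show ?thesis by (simp add: sin_30)
    qed
    moreover have "\<bar>sin (real T * \<alpha>)\<bar> = \<bar>sin y\<bar>"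
    proof -
      have "sin (y + pi * of_int m) = sin y * cos (pi * of_int m)"
        by (simp add: sin_add sin_npi_int)
      moreover have "\<bar>cos (pi * of_int m)\<bar> = 1"
        by (simp add: cos_npi_int)
      ultimately show ?thesis by (simp add: y_def abs_mult)
    qed
    ultimately show ?thesis by linarith
  qed
  ultimately show ?thesis by blast
qed

subsection \<open>The mixing distance of a superposition\<close>

text \<open>Subtracting the limit removes the stationary part \<open>p\<close> and leaves the
  interference term, in which position and time separate because both eigenvectors are real. Summing
  \<open>\<bar>q x\<bar>\<close> over the positions yields the overlap.\<close>

lemma mixing_distance_superposition:
  fixes f g :: "complex ^ 'x::finite"
  assumes U: "unitary_operator U"
    and f: "eigenvector U l f" "real_vector f"
    and g: "eigenvector U l' g" "real_vector g"
    and "l \<noteq> l'" "cmod \<omega> = 1" "T > 0"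
  defines "\<phi> \<equiv> complex_of_real (1 / sqrt 2) *s f + (complex_of_real (1 / sqrt 2) * \<omega>) *s g"
  shows "mixing_distance U T \<phi> =
    overlap f g * \<bar>Re (\<omega> * (\<Sum>t<T. (cnj l * l') ^ t))\<bar> / real T"
proof -
  define z where "z = cnj l * l'"
  define p where "p x = ((Re (f $ x))\<^sup>2 + (Re (g $ x))\<^sup>2) / 2" for x
  define q where "q x = Re (f $ x) * Re (g $ x)" for x
  define S where "S T = Re (\<omega> * (\<Sum>t<T. z ^ t))" for T
  have l: "cmod l = 1" "cmod l' = 1"
    using eigenvalue_unitary U f(1) g(1) by blast+
  have real: "f $ x = of_real (Re (f $ x))" "g $ x = of_real (Re (g $ x))" for x
    using f(2) g(2) by (simp_all add: real_vector_def of_real_Re)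
  have "z \<noteq> 1"
    using \<open>l \<noteq> l'\<close> cnj_mult_eq_1_iff[OF l(1)] by (simp add: z_def)
  have "cmod z = 1"
    using l by (simp add: z_def norm_mult)
  \<comment> \<open>Law of cosines for unit phases and real amplitudes: the cross term is
    \<open>u * v\<close>, to depend on position only, times a factor to depend on time only.\<close>
  have polar: "(cmod (a * of_real u + b * of_real v))\<^sup>2 = u\<^sup>2 + v\<^sup>2 + 2 * (u * v) * Re (cnj a * b)"
    if "cmod a = 1" "cmod b = 1" for a b :: complex and u v :: real
  proof -
    have "(Re a)\<^sup>2 + (Im a)\<^sup>2 = 1" "(Re b)\<^sup>2 + (Im b)\<^sup>2 = 1"
      using that cmod_power2[of a] cmod_power2[of b] by simp_all
    moreover have "(cmod (a * of_real u + b * of_real v))\<^sup>2 =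
      ((Re a)\<^sup>2 + (Im a)\<^sup>2) * u\<^sup>2 + ((Re b)\<^sup>2 + (Im b)\<^sup>2) * v\<^sup>2 + 2 * (u * v) * Re (cnj a * b)"
      unfolding cmod_power2 by (simp add: power2_eq_square algebra_simps)
    ultimately show ?thesis by simp
  qed
  have step: "(cmod ((U ^^ t) \<phi> $ x))\<^sup>2 = p x + q x * Re (\<omega> * z ^ t)" for t x
  proof -
    have "(U ^^ t) \<phi> $ x = of_real (1 / sqrt 2) *
        (l ^ t * of_real (Re (f $ x)) + (\<omega> * l' ^ t) * of_real (Re (g $ x)))"
      unfolding \<phi>_def funpow_superposition[OF U f(1) g(1)] real[symmetric]
      by (simp add: algebra_simps)
    then have "(cmod ((U ^^ t) \<phi> $ x))\<^sup>2 = 1 / 2 *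
        (cmod (l ^ t * of_real (Re (f $ x)) + (\<omega> * l' ^ t) * of_real (Re (g $ x))))\<^sup>2"
      by (simp add: norm_mult norm_divide power_mult_distrib power_divide)
    also have "\<dots> = p x + q x * Re (cnj (l ^ t) * (\<omega> * l' ^ t))"
      using l \<open>cmod \<omega> = 1\<close>
      by (subst polar) (simp_all add: norm_power norm_mult p_def q_def field_simps)
    also have "cnj (l ^ t) * (\<omega> * l' ^ t) = \<omega> * z ^ t"
      by (simp add: z_def power_mult_distrib)
    finally show ?thesis .
  qed
  have avg: "time_average U \<phi> T x = p x + q x * (S T / real T)" if "T > 0" for T x
    using that unfolding time_average_def step S_def
    by (simp only: sum.distrib sum_distrib_left[symmetric] Re_sum[symmetric]) (simp add: field_simps)
  \<comment> \<open>Since \<open>z \<noteq> 1\<close>, the geometric sums are bounded uniformly in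
    \<open>T\<close>, so the averaged interference decays like \<open>1 / T\<close>.\<close>
  have bound: "\<bar>S T\<bar> \<le> 2 / cmod (z - 1)" for T
  proof -
    have "\<bar>S T\<bar> \<le> cmod (\<omega> * (\<Sum>t<T. z ^ t))"
      unfolding S_def by (rule abs_Re_le_cmod)
    also have "\<dots> = cmod (z ^ T - 1) / cmod (z - 1)"
      using \<open>z \<noteq> 1\<close> \<open>cmod \<omega> = 1\<close> by (simp add: geometric_sum norm_mult norm_divide)
    also have "\<dots> \<le> 2 / cmod (z - 1)"
      using norm_triangle_ineq4[of "z ^ T" 1] \<open>cmod z = 1\<close>
      by (intro divide_right_mono) (simp_all add: norm_power)
    finally show ?thesis .
  qed
  have "(\<lambda>T. S T / real T) \<longlonglongrightarrow> 0"
  proof (rule tendsto_rabs_zero_cancel, rule tendsto_sandwich)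
    show "\<forall>\<^sub>F T in sequentially. 0 \<le> \<bar>S T / real T\<bar>" by simp
    show "\<forall>\<^sub>F T in sequentially. \<bar>S T / real T\<bar> \<le> 2 / cmod (z - 1) / real T"
      using bound by (auto simp only: abs_divide abs_of_nat intro!: always_eventually divide_right_mono)
    show "(\<lambda>T. 2 / cmod (z - 1) / real T) \<longlonglongrightarrow> 0"
      by (rule lim_const_over_n)
  qed simp
  then have lim: "(\<lambda>T. p x + q x * (S T / real T)) \<longlonglongrightarrow> p x" for x
    using tendsto_add[OF tendsto_const[of "p x"] tendsto_mult_left[of _ 0 _ "q x"]] by fastforce
  \<comment> \<open>The formula \<open>avg\<close> may fail at \<open>T = 0\<close>, where division
    by zero makes the average 0; the sequences are therefore compared from 1 on.\<close>
  have "(\<lambda>T. time_average U \<phi> T x) \<longlonglongrightarrow> p x" for x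
    by (rule Lim_transform_eventually[OF lim])
       (use avg in \<open>auto simp: eventually_sequentially intro!: exI[of _ 1]\<close>)
  then have "limit_distribution U \<phi> x = p x" for x
    unfolding limit_distribution_def by (rule limI)
  then have "mixing_distance U T \<phi> = (\<Sum>x\<in>UNIV. \<bar>q x\<bar>) * (\<bar>S T\<bar> / real T)"
    using avg[OF \<open>T > 0\<close>] by (simp add: mixing_distance_def abs_mult sum_distrib_right sum_divide_distrib)
  moreover have "overlap f g = (\<Sum>x\<in>UNIV. \<bar>q x\<bar>)"
  proof -
    have "cmod (f $ x * g $ x) = \<bar>q x\<bar>" for x
      by (subst real(1), subst real(2)) (simp add: q_def norm_mult abs_mult)
    then show ?thesis by (simp add: overlap_def)
  qed
  ultimately show ?thesis
    by (simp add: S_def z_def)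
qed

section \<open>Lower bounds for the mixing time\<close>

lemma mixing_time_ge:
  assumes "norm \<phi> = 1" "L \<le> real T" "\<epsilon> < mixing_distance U T \<phi>"
  shows "ereal L \<le> mixing_time U \<epsilon>"
proof -
  have "ereal L \<le> (INF T\<in>{T. 1 \<le> T \<and> (\<forall>T'\<ge>T. mixing_distance U T' \<phi> \<le> \<epsilon>)}. ereal (real T))"
  proof (rule INF_greatest)
    fix N assume "N \<in> {T. 1 \<le> T \<and> (\<forall>T'\<ge>T. mixing_distance U T' \<phi> \<le> \<epsilon>)}"
    \<comment> \<open>A threshold \<open>N\<close> not exceeding \<open>T\<close> would force the
      distance at \<open>T\<close> itself to be at most \<open>\<epsilon>\<close>.\<close>
    then have "T < N"
      using assms(3) by (metis (mono_tags) mem_Collect_eq linorder_not_less)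
    then show "ereal L \<le> ereal (real N)"
      using assms(2) by simp
  qed
  also have "\<dots> \<le> mixing_time U \<epsilon>"
    unfolding mixing_time_def using assms(1) by (intro SUP_upper) simp
  finally show ?thesis .
qed

text \<open>At a suitable \<open>T\<close> between \<open>L\<close> and \<open>2 * L\<close> the
  geometric sum has modulus at least \<open>1 / (2 * \<alpha>)\<close>. As the overlap is
  \<open>16 * \<epsilon> * L * \<alpha>\<close>, the mixing distance at \<open>T\<close> is then at
  least \<open>4 * \<epsilon>\<close>.\<close>

lemma mixing_time_ge_real:
  fixes f g :: "complex ^ 'x::finite"
  assumes U: "unitary_operator U"
    and f: "eigenvector U l f" "real_vector f" "norm f = 1"
    and g: "eigenvector U l' g" "real_vector g" "norm g = 1"
    and "l \<noteq> l'" "circle_dist l l' \<le> 2" "0 < \<epsilon>" "\<epsilon> \<le> overlap f g / 80"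
  shows "ereal (overlap f g / (8 * \<epsilon> * circle_dist l l')) \<le> mixing_time U \<epsilon>"
proof -
  define \<alpha> where "\<alpha> = circle_dist l l' / 2"
  define z where "z = cnj l * l'"
  define L where "L = overlap f g / (8 * \<epsilon> * circle_dist l l')"
  have l: "cmod l = 1" "cmod l' = 1"
    using eigenvalue_unitary U f(1) g(1) by blast+
  have "z \<noteq> 1"
    using \<open>l \<noteq> l'\<close> cnj_mult_eq_1_iff[OF l(1)] by (simp add: z_def)
  have sin: "cmod (z ^ T - 1) = 2 * \<bar>sin (real T * \<alpha>)\<bar>" for T
    unfolding z_def \<alpha>_def by (rule norm_quotient_power_minus_1[OF l])
  have "\<alpha> \<noteq> 0"
    using sin[of 1] \<open>z \<noteq> 1\<close> by auto
  moreover have "\<alpha> \<ge> 0"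
    unfolding \<alpha>_def using circle_dist_attained[of l l'] by auto
  ultimately have \<alpha>: "\<alpha> > 0" "\<alpha> \<le> 1"
    using assms by (auto simp: \<alpha>_def)
  have L: "L * \<alpha> = overlap f g / (16 * \<epsilon>)"
    using \<alpha> \<open>0 < \<epsilon>\<close> by (simp add: L_def \<alpha>_def field_simps)
  \<comment> \<open>The constant 80 is 16 times the 5 required for the choice of
    \<open>T\<close>.\<close>
  moreover have "5 \<le> overlap f g / (16 * \<epsilon>)"
    using assms by (simp add: field_simps)
  ultimately have "5 \<le> L * \<alpha>" by simp
  then obtain T where T: "L \<le> real T" "real T \<le> 2 * L" "\<bar>sin (real T * \<alpha>)\<bar> \<ge> 1 / 2"
    using exists_time_away_from_multiples_of_pi \<alpha> by blast
  have "L > 0"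
    using \<open>5 \<le> L * \<alpha>\<close> \<alpha> by (smt (verit) mult_nonpos_nonneg)
  then have "T > 0" using T(1) by (cases T) auto
  define w where "w = (\<Sum>t<T. z ^ t)"
  \<comment> \<open>This phase rotates \<open>w\<close> onto the positive real axis, so that passing
    to the real part loses nothing.\<close>
  define \<omega> where "\<omega> = cnj (sgn w)"
  have w: "cmod w = cmod (z ^ T - 1) / cmod (z - 1)"
    using \<open>z \<noteq> 1\<close> by (simp add: w_def geometric_sum norm_divide)
  have "cmod (z - 1) \<le> 2 * \<alpha>"
    using sin[of 1] abs_sin_x_le_abs_x[of \<alpha>] \<alpha> by simp
  moreover have "cmod (z ^ T - 1) \<ge> 1"
    using T(3) by (simp add: sin)
  moreover have "cmod (z - 1) > 0"
    using \<open>z \<noteq> 1\<close> by simp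
  \<comment> \<open>The numerator is at least 1 by the choice of \<open>T\<close>, and the
    denominator is \<open>2 * \<bar>sin \<alpha>\<bar>\<close>, hence at most
    \<open>2 * \<alpha>\<close>.\<close>
  ultimately have w_ge: "cmod w \<ge> 1 / (2 * \<alpha>)"
    unfolding w by (intro frac_le) auto
  then have "w \<noteq> 0"
    using \<alpha> by auto
  then have "cmod \<omega> = 1"
    by (simp add: \<omega>_def norm_sgn)
  have "\<omega> * w = of_real (cmod w)"
    using \<open>w \<noteq> 0\<close> complex_norm_square[of w]
    by (simp add: \<omega>_def sgn_eq field_simps power2_eq_square)
  define \<phi> where "\<phi> = complex_of_real (1 / sqrt 2) *s f + (complex_of_real (1 / sqrt 2) * \<omega>) *s g"
  have "norm \<phi> = 1"
    unfolding \<phi>_def using \<open>cmod \<omega> = 1\<close> eigenvectors_orthogonal[OF U f(1) g(1) \<open>l \<noteq> l'\<close>] f g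
    by (intro norm_superposition) (simp_all add: norm_mult norm_divide power_divide)
  moreover have "mixing_distance U T \<phi> = overlap f g * cmod w / real T"
    using mixing_distance_superposition[OF U f(1,2) g(1,2) \<open>l \<noteq> l'\<close> \<open>cmod \<omega> = 1\<close> \<open>T > 0\<close>]
      \<open>\<omega> * w = of_real (cmod w)\<close>
    unfolding \<phi>_def z_def[symmetric] w_def[symmetric] by simp
  moreover have "\<epsilon> < overlap f g * cmod w / real T"
  proof -
    have ov: "overlap f g = 16 * \<epsilon> * (L * \<alpha>)"
      using L \<open>0 < \<epsilon>\<close> by simp
    have "\<epsilon> * real T \<le> \<epsilon> * (2 * L)"
      using T(2) \<open>0 < \<epsilon>\<close> by (intro mult_left_mono) auto
    also have "\<dots> < \<epsilon> * (8 * L)"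
      using \<open>0 < \<epsilon>\<close> \<open>0 < L\<close> by simp
    also have "\<dots> = overlap f g * (1 / (2 * \<alpha>))"
      using \<alpha> by (simp add: ov)
    also have "\<dots> \<le> overlap f g * cmod w"
      using w_ge assms by (intro mult_left_mono) auto
    finally show ?thesis
      using \<open>T > 0\<close> by (simp add: field_simps)
  qed
  ultimately show ?thesis
    using mixing_time_ge[of \<phi> L T \<epsilon> U] T(1) by (simp add: L_def)
qed


theorem theorem1p2:
  fixes E :: "('v::finite \<times> 'v) set"
    and U :: "complex ^ ('v \<times> 's::finite) \<Rightarrow> complex ^ ('v \<times> 's)"
    and \<mu> \<mu>' :: complex
    and \<psi> \<psi>' :: "complex ^ ('v \<times> 's)"
    and \<epsilon> :: real
  assumes "quantum_walk E U"
    and "only_real_eigenvectors U"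
    and "\<mu> \<noteq> \<mu>'"
    and "eigenvector U \<mu> \<psi>" and "norm \<psi> = 1" and "real_up_to_phase \<psi>"
    and "eigenvector U \<mu>' \<psi>'" and "norm \<psi>' = 1" and "real_up_to_phase \<psi>'"
    and "circle_dist \<mu> \<mu>' \<le> 2"
    and "0 < \<epsilon>" and "\<epsilon> \<le> overlap \<psi> \<psi>' / 80"
  shows "mixing_time U \<epsilon> \<ge> ereal (overlap \<psi> \<psi>' / (8 * \<epsilon> * circle_dist \<mu> \<mu>'))"
proof -
  have U: "unitary_operator U"
    using assms(1) by (simp add: quantum_walk_def)
  obtain c c' where c: "cmod c = 1" "real_vector (c *s \<psi>)" and c': "cmod c' = 1" "real_vector (c' *s \<psi>')"
    using \<open>real_up_to_phase \<psi>\<close> \<open>real_up_to_phase \<psi>'\<close> unfolding real_up_to_phase_def by blast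
  have "c \<noteq> 0" "c' \<noteq> 0"
    using c c' by auto
  \<comment> \<open>Overlap and norm see only moduli, so both eigenvectors may be rotated to real
    ones, with the same eigenvalues.\<close>
  have "overlap (c *s \<psi>) (c' *s \<psi>') = overlap \<psi> \<psi>'"
    using c(1) c'(1) by (simp add: overlap_def norm_mult)
  moreover have "norm (c *s \<psi>) = 1" "norm (c' *s \<psi>') = 1"
    using norm_scale_phase c(1) c'(1) \<open>norm \<psi> = 1\<close> \<open>norm \<psi>' = 1\<close> by metis+
  ultimately show ?thesis
    using mixing_time_ge_real[OF U
        eigenvector_scale[OF U \<open>eigenvector U \<mu> \<psi>\<close> \<open>c \<noteq> 0\<close>] c(2) _
        eigenvector_scale[OF U \<open>eigenvector U \<mu>' \<psi>'\<close> \<open>c' \<noteq> 0\<close>] c'(2) _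
        \<open>\<mu> \<noteq> \<mu>'\<close> \<open>circle_dist \<mu> \<mu>' \<le> 2\<close> \<open>0 < \<epsilon>\<close>]
      \<open>\<epsilon> \<le> overlap \<psi> \<psi>' / 80\<close> by metis
qed

end
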